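(* There exists a finite semifield of order $128=2^7$ containing the Galois field $\mathbb{F}_8$ as a subsemifield, hence a fractional semifield of dimension $\frac{7}{3}$ relative to that subsemifield. Explicitly, consider the following $7\times 7$ matrices over $\mathbb{F}_2$: $A_1=I_7$, $$A_2=\begin{pmatrix}0&0&1&0&0&0&0\\1&0&1&0&0&0&0\\0&1&0&0&0&0&0\\0&0&0&1&1&1&1\\0&0&0&1&0&1&0\\0&0&0&0&0&1&1\\0&0&0&0&0&1&0\end{pmatrix},\quad A_3=\begin{pmatrix}0&1&0&0&0&0&0\\0&1&1&0&0&0&0\\1&0&1&0&0&0&0\\0&0&0&0&1&0&0\\0&0&0&1&1&0&0\\0&0&0&1&1&1&1\\0&0&0&1&0&1&0\end{pmatrix},$$ $$A_4=\begin{pmatrix}0&0&0&1&1&0&0\\0&0&0&1&1&1&0\\0&0&0&0&1&0&1\\1&0&0&0&0&0&1\\0&0&1&0&0&1&0\\0&1&1&1&0&1&1\\0&0&0&1&1&0&1\end{pmatrix},\quad A_5=\begin{pmatrix}0&0&0&0&1&0&0\\0&0&0&0&1&1&1\\0&0&0&1&0&1&0\\0&0&1&0&0&1&1\\1&0&1&0&0&0&1\\0&0&0&0&1&1&0\\0&1&1&1&0&1&1\end{pmatrix},$$ $$A_6=\begin{pmatrix}0&0&0&1&0&1&1\\0&0&0&1&1&0&0\\0&0&0&0&1&0&0\\0&0&0&1&0&1&0\\0&1&1&1&1&1&1\\1&0&1&0&1&1&0\\0&0&1&1&0&1&1\end{pmatrix},\quad A_7=\begin{pmatrix}0&0&0&1&1&0&1\\0&0&0&0&1&0&0\\0&0&0&1&0&0&0\\0&1&1&0&1&0&1\\0&1&1&1&0&1&0\\0&0&1&1&1&0&1\\1&0&0&0&1&1&0\end{pmatrix}.$$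 Then $\{A_1,\dots,A_7\}$ is a standard basis. Consequently, let $S$ be an $\mathbb{F}_2$-vector space with basis $\{a_1,\dots,a_7\}$ and let $S$ be endowed with the $\mathbb{F}_2$-bilinear multiplication $a_i a_j=\sum_{k=1}^7 (A_i)_{kj}\,a_k$ for $i,j\in\{1,\dots,7\}$. Then $S$ is a semifield of order $128$ with unity $a_1$. Moreover, the $\mathbb{F}_2$-span $T$ of $\{a_1,a_2,a_3\}$ is a subsemifield of $S$ isomorphic to $\mathbb{F}_8$, with $a_3=a_2^2$ and $a_2^3=a_2+1$ (where $1=a_1$), so that the dimension of $S$ with respect to $T$ is $\frac{7}{3}$.
   Context: A finite semifield $(S,+,\cdot)$ is a finite, not necessarily associative, division ring with unity: $(S,+)$ is an abelian group, both distributive laws hold, there is a two-sided multiplicative identity $1\neq 0$, and there are no zero divisors ($xy=0$ implies $x=0$ or $y=0$); by finiteness, left and right multiplications by nonzero elements are then bijective. A subsemifield $T$ of $S$ is a subset that is a semifield under the restrictions of $+$ and $\cdot$. If $|S|=p^n$ and $|T|=p^m$ with $p$ prime, the dimension of $S$ with respect to $T$ is $\frac{n}{m}$; if this number is not an integer, $S$ is called a fractional (dimensional) semifield. A standard basis (for order $2^7$) is a set of seven matrices $\{A_i\}_{i=1}^7\subseteq GL(7,2)$ such that: (1) $A_1$ is the identity matrix; (2) for every nonzero $(\lambda_1,\dots,\lambda_7)\in\mathbb{F}_2^7$, the linear combination $\sum_{i=1}^7\lambda_iA_i$ is invertible; (3) for each $i$, the first column of $A_i$ is the column vector with a $1$ in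 position $i$ and $0$ elsewhere. Here $(A)_{kj}$ denotes the entry of $A$ in row $k$ and column $j$; thus $A_i$ is the coordinate matrix, acting on column vectors, of left multiplication $w\mapsto a_iw$ with respect to the basis $\{a_1,\dots,a_7\}$. *)

theory Defs
  imports
    "HOL-Analysis.Determinants"
    "HOL-Computational_Algebra.Primes"
    "HOL-Library.Z2"
    "HOL-Library.Numeral_Type"
    "HOL-Algebra.QuotRing"
begin

text \<open>
  Structures are HOL-Algebra ring records. The product need not be associative, so the multiplicative
  laws are stated directly instead of through the library's monoid or ring locales.
\<close>

locale finite_semifield = abelian_group S for S (structure) +
  assumes finite_carrier: "finite (carrier S)"
    and mult_closed: "\<lbrakk>x \<in> carrier S; y \<in> carrier S\<rbrakk> \<Longrightarrow> x \<otimes> y \<in> carrier S"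
    and one_in_carrier: "\<one> \<in> carrier S"
    and one_neq_zero: "\<one> \<noteq> \<zero>"
    and one_mult: "x \<in> carrier S \<Longrightarrow> \<one> \<otimes> x = x"
    and mult_one: "x \<in> carrier S \<Longrightarrow> x \<otimes> \<one> = x"
    and left_distrib:
      "\<lbrakk>x \<in> carrier S; y \<in> carrier S; z \<in> carrier S\<rbrakk> \<Longrightarrow> (x \<oplus> y) \<otimes> z = x \<otimes> z \<oplus> y \<otimes> z"
    and right_distrib:
      "\<lbrakk>x \<in> carrier S; y \<in> carrier S; z \<in> carrier S\<rbrakk> \<Longrightarrow> z \<otimes> (x \<oplus> y) = z \<otimes> x \<oplus> z \<otimes> y"
    and no_zero_divisors:
      "\<lbrakk>x \<in> carrier S; y \<in> carrier S; x \<otimes> y = \<zero>\<rbrakk> \<Longrightarrow> x = \<zero> \<or> y = \<zero>"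

text \<open>
  No generality is lost by keeping the zero and the unity of \<open>S\<close>: an additive idempotent of \<open>S\<close> is
  zero, and a nonzero \<open>e\<close> with \<open>e \<otimes> e = e = e \<otimes> \<one>\<close> equals \<open>\<one>\<close> because \<open>S\<close> has no zero divisors.
\<close>

definition subsemifield :: "'a set \<Rightarrow> ('a, 'm) ring_scheme \<Rightarrow> bool" where
  "subsemifield T S \<longleftrightarrow> finite_semifield S \<and> T \<subseteq> carrier S \<and> finite_semifield (S\<lparr>carrier := T\<rparr>)"

definition semifield_dim :: "('a, 'm) ring_scheme \<Rightarrow> 'a set \<Rightarrow> rat" where
  "semifield_dim S T = (THE d. \<exists>p n m. prime (p::nat) \<and> order S = p ^ n \<and> card T = p ^ m
                                        \<and> d = of_nat n / of_nat m)"

definition fractional_semifield :: "('a, 'm) ring_scheme \<Rightarrow> 'a set \<Rightarrow> bool" where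
  "fractional_semifield S T \<longleftrightarrow> subsemifield T S \<and> semifield_dim S T \<notin> \<int>"

definition galois_field :: "nat \<Rightarrow> ('a, 'm) ring_scheme \<Rightarrow> bool" where
  "galois_field q F \<longleftrightarrow> field F \<and> finite (carrier F) \<and> order F = q"

text \<open>
  The index type \<open>7\<close> is the integers modulo 7, so the indices 1, ..., 7 are all its elements
  (with \<open>7 = 0\<close>). Entry \<open>M $ k $ j\<close> is in row \<open>k\<close> and column \<open>j\<close>, and \<open>vector\<close> fills the
  positions 1, ..., 7 in order, so a matrix is listed row by row.
\<close>

definition standard_basis :: "(7 \<Rightarrow> bit^7^7) \<Rightarrow> bool" where
  "standard_basis A \<longleftrightarrow>
     (\<forall>i. invertible (A i)) \<and>
     A 1 = mat 1 \<and>
     (\<forall>l :: bit^7. l \<noteq> 0 \<longrightarrow> invertible (\<Sum>i\<in>UNIV. map_matrix ((*) (l $ i)) (A i))) \<and>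
     (\<forall>i. column 1 (A i) = axis i 1)"

definition A2 :: "bit^7^7" where
  "A2 = vector [
     vector [0,0,1,0,0,0,0],
     vector [1,0,1,0,0,0,0],
     vector [0,1,0,0,0,0,0],
     vector [0,0,0,1,1,1,1],
     vector [0,0,0,1,0,1,0],
     vector [0,0,0,0,0,1,1],
     vector [0,0,0,0,0,1,0]]"

definition A3 :: "bit^7^7" where
  "A3 = vector [
     vector [0,1,0,0,0,0,0],
     vector [0,1,1,0,0,0,0],
     vector [1,0,1,0,0,0,0],
     vector [0,0,0,0,1,0,0],
     vector [0,0,0,1,1,0,0],
     vector [0,0,0,1,1,1,1],
     vector [0,0,0,1,0,1,0]]"

definition A4 :: "bit^7^7" where
  "A4 = vector [
     vector [0,0,0,1,1,0,0],
     vector [0,0,0,1,1,1,0],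
     vector [0,0,0,0,1,0,1],
     vector [1,0,0,0,0,0,1],
     vector [0,0,1,0,0,1,0],
     vector [0,1,1,1,0,1,1],
     vector [0,0,0,1,1,0,1]]"

definition A5 :: "bit^7^7" where
  "A5 = vector [
     vector [0,0,0,0,1,0,0],
     vector [0,0,0,0,1,1,1],
     vector [0,0,0,1,0,1,0],
     vector [0,0,1,0,0,1,1],
     vector [1,0,1,0,0,0,1],
     vector [0,0,0,0,1,1,0],
     vector [0,1,1,1,0,1,1]]"

definition A6 :: "bit^7^7" where
  "A6 = vector [
     vector [0,0,0,1,0,1,1],
     vector [0,0,0,1,1,0,0],
     vector [0,0,0,0,1,0,0],
     vector [0,0,0,1,0,1,0],
     vector [0,1,1,1,1,1,1],
     vector [1,0,1,0,1,1,0],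
     vector [0,0,1,1,0,1,1]]"

definition A7 :: "bit^7^7" where
  "A7 = vector [
     vector [0,0,0,1,1,0,1],
     vector [0,0,0,0,1,0,0],
     vector [0,0,0,1,0,0,0],
     vector [0,1,1,0,1,0,1],
     vector [0,1,1,1,0,1,0],
     vector [0,0,1,1,1,0,1],
     vector [1,0,0,0,1,1,0]]"

definition Amat :: "7 \<Rightarrow> bit^7^7" where
  "Amat i = vector [mat 1, A2, A3, A4, A5, A6, A7] $ i"

definition is_basis_family :: "(bit \<Rightarrow> 'v \<Rightarrow> 'v::ab_group_add) \<Rightarrow> (7 \<Rightarrow> 'v) \<Rightarrow> bool" where
  "is_basis_family sc a \<longleftrightarrow> inj a \<and> finite_dimensional_vector_space sc (range a)"

definition bilinear_product :: "(bit \<Rightarrow> 'v \<Rightarrow> 'v::ab_group_add) \<Rightarrow> ('v \<Rightarrow> 'v \<Rightarrow> 'v) \<Rightarrow> bool" where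
  "bilinear_product sc m \<longleftrightarrow>
     (\<forall>x. Vector_Spaces.linear sc sc (\<lambda>y. m x y)) \<and>
     (\<forall>y. Vector_Spaces.linear sc sc (\<lambda>x. m x y))"

definition has_structure_matrices ::
    "(bit \<Rightarrow> 'v \<Rightarrow> 'v::ab_group_add) \<Rightarrow> (7 \<Rightarrow> 'v) \<Rightarrow> (7 \<Rightarrow> bit^7^7) \<Rightarrow> ('v \<Rightarrow> 'v \<Rightarrow> 'v) \<Rightarrow> bool" where
  "has_structure_matrices sc a A m \<longleftrightarrow>
     (\<forall>i j. m (a i) (a j) = (\<Sum>k\<in>UNIV. sc (A i $ k $ j) (a k)))"

definition alg :: "('v \<Rightarrow> 'v \<Rightarrow> 'v) \<Rightarrow> 'v \<Rightarrow> 'v::ab_group_add ring" where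
  "alg m u = \<lparr>carrier = UNIV, mult = m, one = u, zero = 0, add = (+)\<rparr>"

end

theory Submission
  imports Defs "HOL-Algebra.Multiplicative_Group"
begin

text \<open>
  Over the field with two elements a standard basis is a finite check: the 127 nonzero combinations of
  the matrices must each have the property that their 127 nonzero row combinations do not vanish.
  The structure matrices determine the bilinear product, in coordinates
  \<open>x y = (\<Sum>i. x\<^sub>i A\<^sub>i) y\<close>, so invertibility of the combinations excludes zero divisors; \<open>A\<^sub>1 = I\<close> and the
  condition on first columns make \<open>a\<^sub>1\<close> a two-sided unity. On the span of \<open>a\<^sub>1, a\<^sub>2, a\<^sub>3\<close> the product is that
  of polynomials of degree at most 2 modulo \<open>X\<^sup>3 = X + 1\<close>, with \<open>a\<^sub>2\<close> as \<open>X\<close>. Every field of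
  order 8 contains a root of this cubic: any \<open>b \<noteq> 0, 1\<close> satisfies \<open>b\<^sup>7 = 1\<close>, so
  \<open>(b\<^sup>3 + b + 1) (b\<^sup>3 + b\<^sup>2 + 1) = 0\<close>, and \<open>b\<close> or \<open>b + 1\<close> is a root.
\<close>

section \<open>The standard basis\<close>

lemma exhaust_7:
  fixes x :: 7
  shows "x = 1 \<or> x = 2 \<or> x = 3 \<or> x = 4 \<or> x = 5 \<or> x = 6 \<or> x = 7"
proof (induct x)
  case (of_int z)
  \<comment> \<open>The representatives of the index type run from 0 to 6, and the residue 0 is the
    index 7.\<close>
  then have "z = 0 \<or> z = 1 \<or> z = 2 \<or> z = 3 \<or> z = 4 \<or> z = 5 \<or> z = 6" by (simp; arith)
  then show ?case by auto
qed

lemma vector_7: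
  "(vector [a1, a2, a3, a4, a5, a6, a7] :: 'a::zero^7) $ 1 = a1"
  "(vector [a1, a2, a3, a4, a5, a6, a7] :: 'a::zero^7) $ 2 = a2"
  "(vector [a1, a2, a3, a4, a5, a6, a7] :: 'a::zero^7) $ 3 = a3"
  "(vector [a1, a2, a3, a4, a5, a6, a7] :: 'a::zero^7) $ 4 = a4"
  "(vector [a1, a2, a3, a4, a5, a6, a7] :: 'a::zero^7) $ 5 = a5"
  "(vector [a1, a2, a3, a4, a5, a6, a7] :: 'a::zero^7) $ 6 = a6"
  "(vector [a1, a2, a3, a4, a5, a6, a7] :: 'a::zero^7) $ 7 = a7"
  unfolding vector_def by simp_all

lemma forall_7: "(\<forall>i::7. P i) \<longleftrightarrow> P 1 \<and> P 2 \<and> P 3 \<and> P 4 \<and> P 5 \<and> P 6 \<and> P 7"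
  by (metis exhaust_7)

lemma UNIV_7: "(UNIV :: 7 set) = {1, 2, 3, 4, 5, 6, 7}"
  using exhaust_7 by auto

text \<open>The bracketing to the right is that of an unfolded \<open>sum_list\<close>, so the
  finite check below applies to sums over all indices.\<close>

lemma sum_7: "sum f (UNIV::7 set) = f 1 + (f 2 + (f 3 + (f 4 + (f 5 + (f 6 + f 7)))))"
  unfolding UNIV_7 by simp

lemma vector_7_add:
  "(vector [a1, a2, a3, a4, a5, a6, a7] :: 'a::monoid_add^7) + vector [b1, b2, b3, b4, b5, b6, b7]
   = vector [a1 + b1, a2 + b2, a3 + b3, a4 + b4, a5 + b5, a6 + b6, a7 + b7]"
  by (simp add: vec_eq_iff forall_7 vector_7)

text \<open>The argument \<open>z\<close> accumulates the partial sum while each further entry is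
  either skipped or added. Shared initial parts of the sums are thus computed once.\<close>

primrec all_combs :: "('a::monoid_add \<Rightarrow> bool) \<Rightarrow> 'a list \<Rightarrow> 'a \<Rightarrow> bool" where
  "all_combs P [] z \<longleftrightarrow> P z"
| "all_combs P (c # cs) z \<longleftrightarrow> all_combs P cs z \<and> all_combs P cs (z + c)"

text \<open>The cases are split by the first entry with a nonzero coefficient. Over two elements
  that coefficient is 1, so the accumulation starts at \<open>c\<close>.\<close>

primrec all_nonzero_combs :: "('a::monoid_add \<Rightarrow> bool) \<Rightarrow> 'a list \<Rightarrow> bool" where
  "all_nonzero_combs P [] \<longleftrightarrow> True"
| "all_nonzero_combs P (c # cs) \<longleftrightarrow> all_combs P cs c \<and> all_nonzero_combs P cs"

definition rows_independent :: "bit^7^7 \<Rightarrow> bool" where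
  "rows_independent M \<longleftrightarrow> all_nonzero_combs (\<lambda>v. v \<noteq> 0) [M$1, M$2, M$3, M$4, M$5, M$6, M$7]"

lemma mat_1_7: "(mat 1 :: bit^7^7) = vector [
     vector [1,0,0,0,0,0,0],
     vector [0,1,0,0,0,0,0],
     vector [0,0,1,0,0,0,0],
     vector [0,0,0,1,0,0,0],
     vector [0,0,0,0,1,0,0],
     vector [0,0,0,0,0,1,0],
     vector [0,0,0,0,0,0,1]]"
  by (simp add: vec_eq_iff forall_7 vector_7 mat_def)

lemma bit_add_simps: "(0::bit) + 0 = 0" "(0::bit) + 1 = 1" "(1::bit) + 0 = 1" "(1::bit) + 1 = 0"
  by simp_all

text \<open>In this form \<open>bit_eq_simps\<close> decides each disjunct once the entries have
  been evaluated.\<close>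

lemma bit_vector_7_nonzero: "(vector [a1, a2, a3, a4, a5, a6, a7] :: bit^7) \<noteq> 0 \<longleftrightarrow>
   a1 = 1 \<or> a2 = 1 \<or> a3 = 1 \<or> a4 = 1 \<or> a5 = 1 \<or> a6 = 1 \<or> a7 = 1"
  by (auto simp: vec_eq_iff forall_7 vector_7)

lemma bit_eq_simps: "(0::bit) = 1 \<longleftrightarrow> False" "(1::bit) = 1 \<longleftrightarrow> True"
  by simp_all
text \<open>The scalar action is an abstract \<open>s\<close>, so that the same lemma serves row
  vectors and whole matrices.\<close>

lemma all_combsD:
  fixes s :: "bit \<Rightarrow> 'a \<Rightarrow> 'a::monoid_add"
  assumes s: "\<And>x. s 0 x = 0" "\<And>x. s 1 x = x"
    and "length b = length cs" and "all_combs P cs z"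
  shows "P (z + sum_list (map2 s b cs))"
  using assms(3,4)
proof (induction b cs arbitrary: z rule: list_induct2)
  case (Cons x b c cs)
  then show ?case
    using Cons.IH[of z] Cons.IH[of "z + c"] by (cases x) (auto simp: s add.assoc)
qed simp

text \<open>Induction up to the first coefficient 1; from there \<open>all_combsD\<close> takes over
  with start value \<open>c\<close>.\<close>

lemma all_nonzero_combsD:
  fixes s :: "bit \<Rightarrow> 'a \<Rightarrow> 'a::monoid_add"
  assumes s: "\<And>x. s 0 x = 0" "\<And>x. s 1 x = x"
    and "length b = length cs" and "all_nonzero_combs P cs" and "1 \<in> set b"
  shows "P (sum_list (map2 s b cs))"
  using assms(3-)
proof (induction b cs rule: list_induct2)
  case (Cons x b c cs)
  then show ?case
    using all_combsD[where s = s, OF s, of b cs P c] by (cases x) (auto simp: s)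
qed simp

lemma nonzero_bit_vec_7:
  assumes "(x :: bit^7) \<noteq> 0"
  shows "1 \<in> set [x$1, x$2, x$3, x$4, x$5, x$6, x$7]"
  using assms by (auto simp: vec_eq_iff forall_7)

text \<open>A vanishing combination of rows with a nonzero coefficient vector is one of the sums
  that the check excludes, and independent rows yield a right inverse.\<close>

lemma rows_independent_imp_invertible:
  assumes "rows_independent M"
  shows "invertible M"
proof -
  have "x = 0" if "(\<Sum>i\<in>UNIV. x $ i *s row i M) = 0" for x :: "bit^7"
  proof (rule ccontr)
    assume "x \<noteq> 0"
    with that all_nonzero_combsD[where s = "(*s)", OF _ _ _ assms[unfolded rows_independent_def]
        nonzero_bit_vec_7]
    show False by (simp add: sum_7 row_def vec_lambda_eta)
  qed
  then have "\<forall>i. c i = 0" if "(\<Sum>i\<in>UNIV. c i *s row i M) = 0" for c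
    using that by (metis (no_types, lifting) vec_lambda_beta vec_lambda_unique sum.cong zero_index)
  then show ?thesis
    unfolding invertible_right_inverse matrix_right_invertible_independent_rows by blast
qed

lemma all_nonzero_combs_rows_independent: "all_nonzero_combs rows_independent [mat 1, A2, A3, A4, A5, A6, A7]"
  unfolding mat_1_7 A2_def A3_def A4_def A5_def A6_def A7_def
  \<comment> \<open>\<open>simp only\<close> keeps the default rules for \<open>bit\<close>, which turn sums into case distinctions, out of the evaluation\<close>
  by (simp only: rows_independent_def vector_7 vector_7_add bit_vector_7_nonzero bit_add_simps
      bit_eq_simps simp_thms all_combs.simps all_nonzero_combs.simps)

lemma nonzero_comb_invertible:
  assumes "l \<noteq> 0"
  shows "invertible (\<Sum>i\<in>UNIV. map_matrix ((*) (l $ i)) (Amat i))"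
proof -
  have s: "map_matrix ((*) 0) M = 0" "map_matrix ((*) 1) M = M" for M :: "bit^7^7"
    by (simp_all add: vec_eq_iff)
  show ?thesis
    using all_nonzero_combsD[where s = "\<lambda>b. map_matrix ((*) b)",
        OF s _ all_nonzero_combs_rows_independent nonzero_bit_vec_7[OF assms]]
    by (intro rows_independent_imp_invertible) (simp add: sum_7 Amat_def vector_7)
qed

lemma standard_basis_Amat: "standard_basis Amat"
proof -
  \<comment> \<open>Invertibility of a single matrix is the case of a unit coefficient
    vector.\<close>
  have "map_matrix ((*) (axis i 1 $ j)) (Amat j) = (if j = i then Amat j else 0)" for i j
    by (simp add: vec_eq_iff axis_def)
  then have "(\<Sum>j\<in>UNIV. map_matrix ((*) (axis i 1 $ j)) (Amat j)) = Amat i" for i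
    by simp
  with nonzero_comb_invertible[of "axis i 1" for i] have "invertible (Amat i)" for i
    by (simp add: axis_eq_0_iff)
  moreover have "\<forall>i. column 1 (Amat i) = axis i 1"
    unfolding forall_7
    by (simp add: Amat_def vector_7 column_def mat_1_7 A2_def A3_def A4_def A5_def A6_def A7_def
        vec_eq_iff forall_7 axis_def)
  moreover have "Amat 1 = mat 1"
    by (simp add: Amat_def vector_7)
  ultimately show ?thesis
    unfolding standard_basis_def using nonzero_comb_invertible by blast
qed

section \<open>The field with eight elements\<close>

text \<open>The triple \<open>(c0, c1, c2)\<close> stands for \<open>c0 + c1 X + c2 X\<^sup>2\<close> modulo \<open>X\<^sup>3 = X + 1\<close>.\<close>

definition cubic_mult :: "'a::comm_ring_1 \<times> 'a \<times> 'a \<Rightarrow> 'a \<times> 'a \<times> 'a \<Rightarrow> 'a \<times> 'a \<times> 'a" where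
  "cubic_mult = (\<lambda>(c0, c1, c2) (d0, d1, d2).
     (c0 * d0 + c1 * d2 + c2 * d1,
      c0 * d1 + c1 * d0 + c1 * d2 + c2 * d1 + c2 * d2,
      c0 * d2 + c1 * d1 + c2 * d0 + c2 * d2))"

text \<open>This is the product modulo X^3 - X - 1 over any commutative ring, so the law is a
  polynomial identity in nine entries and involves no cases over \<open>bit\<close>.\<close>

lemma cubic_mult_assoc: "cubic_mult (cubic_mult c d) e = cubic_mult c (cubic_mult d e)"
  by (cases c; cases d; cases e) (simp add: cubic_mult_def algebra_simps)

lemma cubic_mult_commute: "cubic_mult c d = cubic_mult d c"
  by (cases c; cases d) (simp add: cubic_mult_def algebra_simps)

lemma cubic_mult_distrib: "cubic_mult (c + d) e = cubic_mult c e + cubic_mult d e"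
  by (cases c; cases d; cases e) (simp add: cubic_mult_def algebra_simps)

lemma cubic_mult_one: "cubic_mult (1, 0, 0) c = c"
  by (cases c) (simp add: cubic_mult_def)

definition gf8 :: "(bit \<times> bit \<times> bit) ring" where
  "gf8 = \<lparr>carrier = UNIV, mult = cubic_mult, one = (1, 0, 0), zero = 0, add = (+)\<rparr>"

lemma UNIV_bit: "(UNIV :: bit set) = {0, 1}"
  using bit_not_zero_iff by blast

lemma ex_bit: "(\<exists>b :: bit. P b) \<longleftrightarrow> P 0 \<or> P 1"
  by (metis bit_not_zero_iff)

lemma card_UNIV_bit: "CARD(bit) = 2"
  by (simp add: UNIV_bit)

text \<open>This reflects the irreducibility of X^3 + X + 1. Each nonzero triple is tested against
  the eight candidates that \<open>ex_bit\<close> produces.\<close>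

lemma cubic_mult_inverse:
  fixes c :: "bit \<times> bit \<times> bit"
  assumes "c \<noteq> 0"
  shows "\<exists>d. cubic_mult c d = (1, 0, 0)"
proof -
  obtain c0 c1 c2 :: bit where c: "c = (c0, c1, c2)" by (cases c)
  have "\<exists>d0 d1 d2. cubic_mult c (d0, d1, d2) = (1, 0, 0)"
    using assms
    unfolding c by (cases c0; cases c1; cases c2) (simp_all add: cubic_mult_def zero_prod_def ex_bit)
  then show ?thesis by blast
qed

lemma field_gf8: "field gf8"
proof -
  interpret cring gf8
  proof (rule cringI)
    show "abelian_group gf8"
    proof (rule abelian_groupI)
      fix c assume "c \<in> carrier gf8"
      show "\<exists>d\<in>carrier gf8. d \<oplus>\<^bsub>gf8\<^esub> c = \<zero>\<^bsub>gf8\<^esub>"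
        by (rule bexI[of _ "- c"]) (simp_all add: gf8_def)
    qed (simp_all add: gf8_def add_ac)
    show "comm_monoid gf8"
      by (rule comm_monoidI)
        (simp_all add: gf8_def cubic_mult_assoc cubic_mult_one, rule cubic_mult_commute)
  qed (simp add: gf8_def cubic_mult_distrib)
  show ?thesis
  proof (rule cring_fieldI2)
    show "\<zero>\<^bsub>gf8\<^esub> \<noteq> \<one>\<^bsub>gf8\<^esub>" by (simp add: gf8_def zero_prod_def)
  next
    fix c assume "c \<noteq> \<zero>\<^bsub>gf8\<^esub>"
    then show "\<exists>d\<in>carrier gf8. c \<otimes>\<^bsub>gf8\<^esub> d = \<one>\<^bsub>gf8\<^esub>"
      using cubic_mult_inverse[of c] by (simp add: gf8_def)
  qed
qed

lemma galois_field_gf8: "galois_field 8 gf8"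
proof -
  have "order gf8 = 8"
    by (simp add: gf8_def order_def UNIV_Times_UNIV[symmetric] card_cartesian_product card_UNIV_bit
        del: UNIV_Times_UNIV)
  \<comment> \<open>An infinite set has cardinality 0 by default, so order 8 entails
    finiteness.\<close>
  then show ?thesis
    using card_ge_0_finite[of "carrier gf8"] by (simp add: galois_field_def field_gf8 order_def)
qed

section \<open>Uniqueness of the field of order 8\<close>

context field begin

text \<open>In the additive group of order 8 the eightfold multiple of \<open>\<one>\<close>
  vanishes. It equals the cube of \<open>\<one> \<oplus> \<one>\<close>, and a field has no zero
  divisors.\<close>

lemma order_8_imp_char_2:
  assumes "order R = 8"
  shows "\<one> \<oplus> \<one> = \<zero>"
proof -
  have "[order R] \<cdot> \<one> = \<zero>"
    using group.pow_order_eq_1[OF a_group, of \<one>] by (simp add: add_pow_def order_def)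
  then have "[Suc (Suc (Suc (Suc (Suc (Suc (Suc (Suc 0)))))))] \<cdot> \<one> = \<zero>"
    using assms by (simp add: numeral_eq_Suc)
  then have "(\<one> \<oplus> \<one>) \<otimes> ((\<one> \<oplus> \<one>) \<otimes> (\<one> \<oplus> \<one>)) = \<zero>"
    by (simp add: l_distr r_distr a_ac)
  then show ?thesis
    by (simp add: integral_iff)
qed

lemma char_2_add_self:
  assumes "\<one> \<oplus> \<one> = \<zero>" and "x \<in> carrier R"
  shows "x \<oplus> x = \<zero>"
  using assms l_distr[of \<one> \<one> x] by simp

lemma order_8_root:
  assumes "order R = 8"
  obtains \<alpha> where "\<alpha> \<in> carrier R" and "\<alpha> \<otimes> (\<alpha> \<otimes> \<alpha>) = \<alpha> \<oplus> \<one>"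
proof -
  have char2: "\<one> \<oplus> \<one> = \<zero>"
    using assms by (rule order_8_imp_char_2)
  have self: "x \<oplus> x = \<zero>" if "x \<in> carrier R" for x
    using char2 that by (rule char_2_add_self)
  have fin: "finite (carrier R)"
    using assms card.infinite by (fastforce simp: order_def)
  have "\<not> carrier R \<subseteq> {\<zero>, \<one>}"
    using assms card_mono[of "{\<zero>, \<one>}" "carrier R"] by (auto simp: order_def)
  then obtain b where b: "b \<in> carrier R" "b \<noteq> \<zero>" "b \<noteq> \<one>" by blast
  have "b [^] order (mult_of R) = \<one>"
    using group.pow_order_eq_1[OF field_mult_group, of b] b by (simp add: nat_pow_mult_of)
  then have "b [^] Suc (Suc (Suc (Suc (Suc (Suc (Suc 0)))))) = \<one>"
    using assms fin by (simp add: order_mult_of numeral_eq_Suc)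
  then have b7: "b \<otimes> (b \<otimes> (b \<otimes> (b \<otimes> (b \<otimes> (b \<otimes> b))))) = \<one>"
    using b by (simp add: m_assoc)
  let ?P = "b \<otimes> (b \<otimes> b) \<oplus> b \<oplus> \<one>" and ?Q = "b \<otimes> (b \<otimes> b) \<oplus> b \<otimes> b \<oplus> \<one>"
  \<comment> \<open>An identity valid in every commutative ring: all terms of (b + 1) P Q besides
    b^7 + 1 have even coefficients and are collected behind the factor
    \<open>\<one> \<oplus> \<one>\<close>.\<close>
  have "(b \<oplus> \<one>) \<otimes> (?P \<otimes> ?Q) = b \<otimes> (b \<otimes> (b \<otimes> (b \<otimes> (b \<otimes> (b \<otimes> b))))) \<oplus> \<one> \<oplus> (\<one> \<oplus> \<one>) \<otimes>
    (b \<oplus> b \<otimes> b \<oplus> (\<one> \<oplus> \<one>) \<otimes> (b \<otimes> (b \<otimes> b) \<oplus> b \<otimes> (b \<otimes> (b \<otimes> b))) \<oplus>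
      b \<otimes> (b \<otimes> (b \<otimes> (b \<otimes> b))) \<oplus> b \<otimes> (b \<otimes> (b \<otimes> (b \<otimes> (b \<otimes> b)))))"
    using b(1) by (simp add: l_distr r_distr a_ac m_ac)
  also have "\<dots> = \<zero>"
    using b(1) by (simp add: b7 char2)
  finally have "b \<oplus> \<one> = \<zero> \<or> ?P = \<zero> \<or> ?Q = \<zero>"
    using b(1) by (simp add: integral_iff)
  moreover have "b \<oplus> \<one> \<noteq> \<zero>"
    using b(1,3) char2 by (metis a_assoc l_zero one_closed r_zero)
  ultimately consider "?P = \<zero>" | "?Q = \<zero>"
    by blast
  then show thesis
  proof cases
    case 1
    \<comment> \<open>Adding b + 1 twice changes nothing in characteristic 2 and makes the vanishing
      \<open>?P\<close> appear.\<close>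
    have "b \<otimes> (b \<otimes> b) = b \<otimes> (b \<otimes> b) \<oplus> ((b \<oplus> \<one>) \<oplus> (b \<oplus> \<one>))"
      using b(1) self[of "b \<oplus> \<one>"] by simp
    also have "\<dots> = ?P \<oplus> (b \<oplus> \<one>)"
      using b(1) by (simp add: a_ac)
    also have "\<dots> = b \<oplus> \<one>"
      unfolding 1 using b(1) by simp
    finally show thesis using b(1) that by blast
  next
    case 2
    let ?a = "b \<oplus> \<one>"
    \<comment> \<open>The expansion b^3 + 3 b^2 + 3 b + 1 is regrouped as Q + 2 (b^2 + b) + b. With
      Q = 0 only b remains, which is \<open>?a \<oplus> \<one>\<close>.\<close>
    have "?a \<otimes> (?a \<otimes> ?a) = ?Q \<oplus> (\<one> \<oplus> \<one>) \<otimes> (b \<otimes> b \<oplus> b) \<oplus> b"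
      using b(1) by (simp add: l_distr r_distr a_ac m_ac)
    also have "\<dots> = b \<oplus> \<one> \<oplus> \<one>"
      unfolding 2 using b(1) by (simp add: char2 a_assoc)
    finally show thesis using b that[of ?a] by simp
  qed
qed

text \<open>Evaluation at a root \<open>\<alpha>\<close> of the cubic is a homomorphism. It is
  injective because nonzero elements of \<open>gf8\<close> are invertible, and surjective because
  both sides have eight elements.\<close>

lemma order_8_gf8_iso:
  assumes "order R = 8"
  shows "gf8 \<simeq> R"
proof -
  obtain \<alpha> where \<alpha>: "\<alpha> \<in> carrier R" "\<alpha> \<otimes> (\<alpha> \<otimes> \<alpha>) = \<alpha> \<oplus> \<one>"
    using order_8_root[OF assms] .
  have char2: "\<one> \<oplus> \<one> = \<zero>"
    using assms by (rule order_8_imp_char_2)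
  have self: "x \<oplus> x = \<zero>" if "x \<in> carrier R" for x
    using char2 that by (rule char_2_add_self)
  \<comment> \<open>The embedding of the prime field, additive because
    \<open>\<one> \<oplus> \<one> = \<zero>\<close>.\<close>
  define e where "e = (\<lambda>c::bit. if c = 0 then \<zero> else \<one>)"
  have e: "e c \<in> carrier R" "e 0 = \<zero>" "e 1 = \<one>" "e (c + d) = e c \<oplus> e d" "e (c * d) = e c \<otimes> e d" for c d
    by (cases c; cases d; simp add: e_def char2)+
  define h where "h = (\<lambda>(c0, c1, c2). e c0 \<oplus> e c1 \<otimes> \<alpha> \<oplus> e c2 \<otimes> (\<alpha> \<otimes> \<alpha>))"
  have h_carrier: "h c \<in> carrier R" for c
    by (cases c) (simp add: h_def e \<alpha>)
  have h_add: "h (c + d) = h c \<oplus> h d" for c d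
  proof -
    obtain c0 c1 c2 d0 d1 d2 where cd: "c = (c0, c1, c2)" "d = (d0, d1, d2)"
      by (cases c; cases d)
    show ?thesis
      unfolding cd h_def add_Pair prod.case e(4) using \<alpha>(1) e(1)
      by (simp add: l_distr a_ac)
  qed
  have h_mult: "h (cubic_mult c d) = h c \<otimes> h d" for c d
  proof -
    obtain c0 c1 c2 d0 d1 d2 where cd: "c = (c0, c1, c2)" "d = (d0, d1, d2)"
      by (cases c; cases d)
    have *: "u0 \<otimes> v0 \<oplus> u1 \<otimes> v2 \<oplus> u2 \<otimes> v1 \<oplus>
       (u0 \<otimes> v1 \<oplus> u1 \<otimes> v0 \<oplus> u1 \<otimes> v2 \<oplus> u2 \<otimes> v1 \<oplus> u2 \<otimes> v2) \<otimes> \<alpha> \<oplus>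
       (u0 \<otimes> v2 \<oplus> u1 \<otimes> v1 \<oplus> u2 \<otimes> v0 \<oplus> u2 \<otimes> v2) \<otimes> (\<alpha> \<otimes> \<alpha>)
      = (u0 \<oplus> u1 \<otimes> \<alpha> \<oplus> u2 \<otimes> (\<alpha> \<otimes> \<alpha>)) \<otimes> (v0 \<oplus> v1 \<otimes> \<alpha> \<oplus> v2 \<otimes> (\<alpha> \<otimes> \<alpha>))"
      if "u0 \<in> carrier R" "u1 \<in> carrier R" "u2 \<in> carrier R" "v0 \<in> carrier R" "v1 \<in> carrier R" "v2 \<in> carrier R"
      for u0 u1 u2 v0 v1 v2
    proof -
      \<comment> \<open>The product is first sorted by powers of \<open>\<alpha>\<close> up to the
        fourth. The cube is kept as a visible subterm of the fourth power, so the single equation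
        for \<open>\<alpha>\<close> reduces both.\<close>
      have "(u0 \<oplus> u1 \<otimes> \<alpha> \<oplus> u2 \<otimes> (\<alpha> \<otimes> \<alpha>)) \<otimes> (v0 \<oplus> v1 \<otimes> \<alpha> \<oplus> v2 \<otimes> (\<alpha> \<otimes> \<alpha>))
        = u0 \<otimes> v0 \<oplus> (u0 \<otimes> v1 \<oplus> u1 \<otimes> v0) \<otimes> \<alpha> \<oplus>
          (u0 \<otimes> v2 \<oplus> u1 \<otimes> v1 \<oplus> u2 \<otimes> v0) \<otimes> (\<alpha> \<otimes> \<alpha>) \<oplus>
          (u1 \<otimes> v2 \<oplus> u2 \<otimes> v1) \<otimes> (\<alpha> \<otimes> (\<alpha> \<otimes> \<alpha>)) \<oplus> u2 \<otimes> v2 \<otimes> (\<alpha> \<otimes> (\<alpha> \<otimes> (\<alpha> \<otimes> \<alpha>)))"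
        using that \<alpha>(1) by (simp add: l_distr r_distr a_ac m_ac)
      also have "\<dots> = u0 \<otimes> v0 \<oplus> u1 \<otimes> v2 \<oplus> u2 \<otimes> v1 \<oplus>
         (u0 \<otimes> v1 \<oplus> u1 \<otimes> v0 \<oplus> u1 \<otimes> v2 \<oplus> u2 \<otimes> v1 \<oplus> u2 \<otimes> v2) \<otimes> \<alpha> \<oplus>
         (u0 \<otimes> v2 \<oplus> u1 \<otimes> v1 \<oplus> u2 \<otimes> v0 \<oplus> u2 \<otimes> v2) \<otimes> (\<alpha> \<otimes> \<alpha>)"
        unfolding \<alpha>(2) using that \<alpha>(1) by (simp add: l_distr r_distr a_ac m_ac)
      finally show ?thesis by simp
    qed
    show ?thesis
      unfolding cd h_def cubic_mult_def prod.case e(4,5) using e(1) by (intro *)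
  qed
  have h_one: "h (1, 0, 0) = \<one>"
    using \<alpha>(1) by (simp add: h_def gf8_def e)
  \<comment> \<open>In characteristic 2 the sum is the difference. If it were nonzero, its inverse
    would be sent to an inverse of \<open>\<zero>\<close>.\<close>
  have "c = d" if "h c = h d" for c d
  proof (rule ccontr)
    assume "c \<noteq> d"
    then have "c + d \<noteq> 0"
      by (cases c; cases d) (auto simp: zero_prod_def add_eq_0_iff)
    then obtain g where "cubic_mult (c + d) g = (1, 0, 0)"
      using cubic_mult_inverse by blast
    then have "h (c + d) \<otimes> h g = \<one>"
      using h_mult h_one by metis
    moreover have "h (c + d) = \<zero>"
      using that by (simp add: h_add self h_carrier)
    ultimately show False
      using h_carrier by simp
  qed
  then have "inj h" by (simp add: inj_def)
  moreover have "card (carrier R) = CARD(bit \<times> bit \<times> bit)"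
    using assms galois_field_gf8 by (simp add: galois_field_def order_def gf8_def)
  ultimately have "h ` UNIV = carrier R"
    using h_carrier assms by (intro card_subset_eq) (auto simp: card_image order_def intro: card_ge_0_finite)
  with \<open>inj h\<close> have "h \<in> ring_iso gf8 R"
    using h_carrier h_mult h_one h_add
    by (intro ring_iso_memI) (simp_all add: bij_betw_def gf8_def)
  then show ?thesis
    by (auto simp: is_ring_iso_def)
qed

end

lemma galois_field_8_unique:
  fixes F :: "('a, 'm) ring_scheme" and G :: "('b, 'n) ring_scheme"
  assumes "galois_field 8 F" and "galois_field 8 G"
  shows "F \<simeq> G"
  using assms field.order_8_gf8_iso[of F] field.order_8_gf8_iso[of G] ring_iso_set_sym ring_iso_trans
    field.is_ring[OF field_gf8]
  unfolding galois_field_def is_ring_iso_def by blast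

section \<open>Products given by structure matrices\<close>

lemma field_imp_finite_semifield:
  assumes "field F" and "finite (carrier F)"
  shows "finite_semifield F"
proof -
  interpret field F by fact
  show ?thesis
    by unfold_locales (use assms(2) in \<open>auto simp: l_distr r_distr integral_iff\<close>)
qed

text \<open>Since \<open>0 < n\<close>, the prime \<open>q\<close> divides any other prime power
  equal to the order, so the primes agree; then the exponents agree as \<open>q\<close> exceeds
  1.\<close>

lemma semifield_dim_eqI:
  assumes "prime q" and "order S = q ^ n" and "card T = q ^ m" and "0 < n"
  shows "semifield_dim S T = of_nat n / of_nat m"
  unfolding semifield_dim_def
proof (rule the_equality)
  show "\<exists>p n' m'. prime (p::nat) \<and> order S = p ^ n' \<and> card T = p ^ m' \<and>
     (of_nat n / of_nat m :: rat) = of_nat n' / of_nat m'"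
    using assms by blast
next
  fix d :: rat
  assume "\<exists>p n' m'. prime (p::nat) \<and> order S = p ^ n' \<and> card T = p ^ m' \<and> d = of_nat n' / of_nat m'"
  then obtain p n' m' where p: "prime p" "q ^ n = p ^ n'" "q ^ m = p ^ m'" "d = of_nat n' / of_nat m'"
    using assms by auto
  have "q dvd p ^ n'"
    using \<open>0 < n\<close> by (simp flip: p(2))
  then have "q = p"
    using assms(1) p(1) by (meson prime_dvd_power primes_dvd_imp_eq)
  with p prime_gt_1_nat[OF assms(1)] show "d = of_nat n / of_nat m"
    by simp
qed

section \<open>Coordinates with respect to an indexed basis\<close>

locale indexed_basis = vector_space sc
  for sc :: "'k::field \<Rightarrow> 'v \<Rightarrow> 'v::ab_group_add" +
  fixes a :: "'n::finite \<Rightarrow> 'v"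
  assumes inj_a: "inj a" and independent_a: "independent (range a)" and span_a: "span (range a) = UNIV"
begin

definition lincomb :: "'k^'n \<Rightarrow> 'v" where
  "lincomb x = (\<Sum>i\<in>UNIV. sc (x $ i) (a i))"

lemma lincomb_add: "lincomb (x + y) = lincomb x + lincomb y"
  by (simp add: lincomb_def scale_left_distrib sum.distrib)

lemma lincomb_scale: "lincomb (c *s x) = sc c (lincomb x)"
  by (simp add: lincomb_def scale_sum_right)

lemma lincomb_0: "lincomb 0 = 0"
  by (simp add: lincomb_def)

lemma lincomb_axis: "lincomb (axis i 1) = a i"
proof -
  have "sc (axis i 1 $ j) (a j) = (if j = i then a j else 0)" for j
    by (simp add: axis_def)
  then show ?thesis by (simp add: lincomb_def)
qed

text \<open>Independence is a property of the set \<open>range a\<close>, so the coefficients are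
  carried over to that set through the inverse of \<open>a\<close>.\<close>

lemma lincomb_eq_sum_range: "lincomb x = (\<Sum>v\<in>range a. sc (x $ inv_into UNIV a v) v)"
  by (simp add: lincomb_def sum.reindex inj_a)

lemma bij_lincomb: "bij lincomb"
proof (rule bijI)
  show "inj lincomb"
  proof (rule injI)
    fix x y assume "lincomb x = lincomb y"
    then have "lincomb (x - y) = 0"
      using lincomb_add[of "x - y" y] by simp
    then have "(\<Sum>v\<in>range a. sc ((x - y) $ inv_into UNIV a v) v) = 0"
      by (simp only: lincomb_eq_sum_range)
    then have "(x - y) $ inv_into UNIV a (a i) = 0" for i
      using independentD[OF independent_a _ subset_refl, of "\<lambda>v. (x - y) $ inv_into UNIV a v" "a i"]
      by simp
    then show "x = y"
      by (simp add: vec_eq_iff inj_a)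
  qed
  show "surj lincomb"
  proof
    show "UNIV \<subseteq> range lincomb"
    proof
      fix v
      have "v \<in> span (range a)" by (simp add: span_a)
      then obtain u where "v = (\<Sum>w\<in>range a. sc (u w) w)"
        by (auto simp: span_finite)
      then have "v = lincomb (\<chi> i. u (a i))"
        by (simp add: lincomb_def sum.reindex inj_a)
      then show "v \<in> range lincomb" by blast
    qed
  qed simp
qed

abbreviation coords :: "'v \<Rightarrow> 'k^'n" where
  "coords \<equiv> inv_into UNIV lincomb"

lemma lincomb_coords [simp]: "lincomb (coords v) = v"
  using bij_lincomb by (simp add: bij_is_surj surj_f_inv_f)

lemma coords_lincomb [simp]: "coords (lincomb x) = x"
  using bij_lincomb by (simp add: bij_is_inj)

lemma coords_add: "coords (v + w) = coords v + coords w"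
  by (metis coords_lincomb lincomb_coords lincomb_add)

lemma coords_scale: "coords (sc c v) = c *s coords v"
  by (metis coords_lincomb lincomb_coords lincomb_scale)

end

section \<open>The product in coordinates\<close>

definition structure_mult :: "('n \<Rightarrow> 'k::field^'n^'n) \<Rightarrow> 'k^'n \<Rightarrow> 'k^'n \<Rightarrow> 'k^'n::finite" where
  "structure_mult A x y = (\<Sum>i\<in>UNIV. map_matrix ((*) (x $ i)) (A i)) *v y"

text \<open>From this double sum, linear in each of \<open>x\<close> and \<open>y\<close>, the
  bilinearity laws are read off entrywise.\<close>

lemma structure_mult_nth:
  "structure_mult A x y $ k = (\<Sum>i\<in>UNIV. \<Sum>j\<in>UNIV. x $ i * (y $ j * A i $ k $ j))"
proof -
  have "structure_mult A x y $ k = (\<Sum>j\<in>UNIV. \<Sum>i\<in>UNIV. x $ i * (y $ j * A i $ k $ j))"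
    by (simp add: structure_mult_def matrix_vector_mult_def sum_distrib_left mult_ac)
  also have "\<dots> = (\<Sum>i\<in>UNIV. \<Sum>j\<in>UNIV. x $ i * (y $ j * A i $ k $ j))"
    by (rule sum.swap)
  finally show ?thesis .
qed

lemma structure_mult_add_left: "structure_mult A (x + x') y = structure_mult A x y + structure_mult A x' y"
  by (simp add: vec_eq_iff structure_mult_nth distrib_right sum.distrib)

lemma structure_mult_add_right: "structure_mult A x (y + y') = structure_mult A x y + structure_mult A x y'"
  by (simp add: vec_eq_iff structure_mult_nth distrib_left distrib_right sum.distrib)

lemma structure_mult_scale_left: "structure_mult A (c *s x) y = c *s structure_mult A x y"
  by (simp add: vec_eq_iff structure_mult_nth sum_distrib_left mult_ac)

lemma structure_mult_scale_right: "structure_mult A x (c *s y) = c *s structure_mult A x y"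
  by (simp add: vec_eq_iff structure_mult_nth sum_distrib_left mult_ac)

lemma structure_mult_axis: "structure_mult A (axis i 1) (axis j 1) = column j (A i)"
proof -
  have "axis i 1 $ i' * (axis j 1 $ j' * A i' $ k $ j') =
      (if j' = j then if i' = i then A i $ k $ j else 0 else 0)" for i' j' k
    by (simp add: axis_def)
  then show ?thesis by (simp add: vec_eq_iff structure_mult_nth column_def)
qed

lemma structure_mult_axis_left: "structure_mult A (axis i 1) x = A i *v x"
proof -
  have "map_matrix ((*) (axis i 1 $ j)) (A j) = (if j = i then A j else 0)" for j
    by (simp add: vec_eq_iff axis_def)
  then show ?thesis
    by (simp add: structure_mult_def)
qed

text \<open>The assumption says that each \<open>A i\<close> sends the unit vector at
  \<open>j\<close> to the one at \<open>i\<close>, so the combination with coefficients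
  \<open>x\<close> sends it to \<open>x\<close>.\<close>

lemma structure_mult_axis_right:
  assumes "\<And>i. column j (A i) = axis i 1"
  shows "structure_mult A x (axis j 1) = x"
proof -
  have "A i $ k $ j = axis i 1 $ k" for i k
    using assms by (simp add: column_def vec_eq_iff)
  then have "x $ i * (axis j 1 $ j' * A i $ k $ j') =
      (if j' = j then if i = k then x $ k else 0 else 0)" for i j' k
    by (simp add: axis_def)
  then show ?thesis
    by (simp add: vec_eq_iff structure_mult_nth)
qed

section \<open>The semifield of order 128\<close>

locale bit_basis_7 = indexed_basis sc a
  for sc :: "bit \<Rightarrow> 'v \<Rightarrow> 'v::ab_group_add" and a :: "7 \<Rightarrow> 'v"
begin

text \<open>Bilinearity reduces the product to products of basis vectors, which the structure
  matrices fix. All later statements about \<open>m\<close> on the whole space pass through this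
  formula.\<close>

lemma mult_lincomb:
  assumes "bilinear_product sc m" and "has_structure_matrices sc a A m"
  shows "m (lincomb x) (lincomb y) = lincomb (structure_mult A x y)"
proof -
  have add: "m (u + v) w = m u w + m v w" "m w (u + v) = m w u + m w v"
    and scale: "m (sc c u) w = sc c (m u w)" "m w (sc c u) = sc c (m w u)" for u v w c
    using assms(1) by (simp_all add: bilinear_product_def Vector_Spaces.linear_iff)
  have zero: "m 0 w = 0" "m w 0 = 0" for w
    using add(1)[of 0 0 w] add(2)[of w 0 0] by simp_all
  have sumL: "m (\<Sum>i\<in>I. f i) w = (\<Sum>i\<in>I. m (f i) w)" if "finite I" for f :: "7 \<Rightarrow> 'v" and I w
    using that by induction (simp_all add: add zero)
  have sumR: "m w (\<Sum>i\<in>I. f i) = (\<Sum>i\<in>I. m w (f i))" if "finite I" for f :: "7 \<Rightarrow> 'v" and I w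
    using that by induction (simp_all add: add zero)
  have "m (lincomb x) (lincomb y) = (\<Sum>i\<in>UNIV. sc (x $ i) (m (a i) (lincomb y)))"
    by (simp only: lincomb_def[of x] sumL[OF finite] scale)
  also have "\<dots> = (\<Sum>i\<in>UNIV. \<Sum>j\<in>UNIV. sc (x $ i) (sc (y $ j) (m (a i) (a j))))"
    by (simp only: lincomb_def sumR[OF finite] scale scale_sum_right)
  also have "\<dots> = (\<Sum>i\<in>UNIV. \<Sum>j\<in>UNIV. \<Sum>k\<in>UNIV. sc (x $ i * (y $ j * A i $ k $ j)) (a k))"
    using assms(2) by (simp only: has_structure_matrices_def scale_sum_right scale_scale)
  also have "\<dots> = lincomb (structure_mult A x y)"
  proof -
    have "lincomb (structure_mult A x y) =
        (\<Sum>k\<in>UNIV. \<Sum>i\<in>UNIV. \<Sum>j\<in>UNIV. sc (x $ i * (y $ j * A i $ k $ j)) (a k))"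
      by (simp only: lincomb_def structure_mult_nth scale_sum_left)
    also have "\<dots> = (\<Sum>i\<in>UNIV. \<Sum>k\<in>UNIV. \<Sum>j\<in>UNIV. sc (x $ i * (y $ j * A i $ k $ j)) (a k))"
      by (rule sum.swap)
    also have "\<dots> = (\<Sum>i\<in>UNIV. \<Sum>j\<in>UNIV. \<Sum>k\<in>UNIV. sc (x $ i * (y $ j * A i $ k $ j)) (a k))"
      by (rule sum.cong[OF refl], rule sum.swap)
    finally show ?thesis by simp
  qed
  finally show ?thesis .
qed

text \<open>Existence transports \<open>structure_mult\<close> along the coordinates; uniqueness is
  \<open>mult_lincomb\<close>.\<close>

lemma ex1_bilinear_product:
  "\<exists>!m. bilinear_product sc m \<and> has_structure_matrices sc a A m"
proof (rule ex1I)
  let ?m = "\<lambda>u v. lincomb (structure_mult A (coords u) (coords v))"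
  have "bilinear_product sc ?m"
    by (simp add: structure_mult_add_left structure_mult_add_right structure_mult_scale_left
        structure_mult_scale_right bilinear_product_def Vector_Spaces.linear_iff vector_space_axioms coords_add coords_scale
        lincomb_add lincomb_scale)
  moreover have "has_structure_matrices sc a A ?m"
  proof -
    have *: "coords (a i) = axis i 1" for i
      by (metis coords_lincomb lincomb_axis)
    then show ?thesis
      by (simp add: has_structure_matrices_def * structure_mult_axis lincomb_def column_def)
  qed
  ultimately show "bilinear_product sc ?m \<and> has_structure_matrices sc a A ?m" ..
  fix m assume "bilinear_product sc m \<and> has_structure_matrices sc a A m"
  then show "m = ?m"
    using mult_lincomb[of m A "coords _" "coords _"] by (simp add: fun_eq_iff)
qed

lemma finite_semifield_alg:
  assumes A: "standard_basis A" and m: "bilinear_product sc m" "has_structure_matrices sc a A m"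
  shows "finite_semifield (alg m (a 1))"
proof -
  have add: "m (u + v) w = m u w + m v w" "m w (u + v) = m w u + m w v" for u v w
    using m(1) by (simp_all add: bilinear_product_def Vector_Spaces.linear_iff)
  interpret abelian_group "alg m (a 1)"
  proof (rule abelian_groupI)
    fix u assume "u \<in> carrier (alg m (a 1))"
    show "\<exists>v\<in>carrier (alg m (a 1)). v \<oplus>\<^bsub>alg m (a 1)\<^esub> u = \<zero>\<^bsub>alg m (a 1)\<^esub>"
      by (rule bexI[of _ "- u"]) (simp_all add: alg_def)
  qed (simp_all add: alg_def add_ac)
  show ?thesis
  proof unfold_locales
    have "finite (UNIV :: (bit^7) set)"
      by (rule card_ge_0_finite) (simp add: card_UNIV_bit)
    then show "finite (carrier (alg m (a 1)))"
      using bij_lincomb by (auto simp: alg_def bij_def dest: finite_imageI[where h = lincomb])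
    show "\<one>\<^bsub>alg m (a 1)\<^esub> \<noteq> \<zero>\<^bsub>alg m (a 1)\<^esub>"
      using independent_a dependent_zero by (auto simp: alg_def)
    fix u v
    show "\<one>\<^bsub>alg m (a 1)\<^esub> \<otimes>\<^bsub>alg m (a 1)\<^esub> u = u"
      using mult_lincomb[OF m, of "axis 1 1" "coords u"] A
      by (simp add: alg_def lincomb_axis structure_mult_axis_left standard_basis_def)
    show "u \<otimes>\<^bsub>alg m (a 1)\<^esub> \<one>\<^bsub>alg m (a 1)\<^esub> = u"
      using mult_lincomb[OF m, of "coords u" "axis 1 1"] A
      by (simp add: alg_def lincomb_axis structure_mult_axis_right standard_basis_def)
    assume "u \<otimes>\<^bsub>alg m (a 1)\<^esub> v = \<zero>\<^bsub>alg m (a 1)\<^esub>"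
    then have "lincomb (structure_mult A (coords u) (coords v)) = lincomb 0"
      using mult_lincomb[OF m, of "coords u" "coords v"] by (simp add: alg_def lincomb_0)
    then have 0: "structure_mult A (coords u) (coords v) = 0"
      by (metis coords_lincomb)
    \<comment> \<open>Left multiplication by a nonzero \<open>u\<close> is an invertible combination
      of the matrices, hence has trivial kernel.\<close>
    have "coords v = 0" if "coords u \<noteq> 0"
    proof -
      have "invertible (\<Sum>i\<in>UNIV. map_matrix ((*) (coords u $ i)) (A i))"
        using A that by (simp add: standard_basis_def)
      then show ?thesis
        using 0 unfolding structure_mult_def invertible_left_inverse matrix_left_invertible_ker by blast
    qed
    then show "u = \<zero>\<^bsub>alg m (a 1)\<^esub> \<or> v = \<zero>\<^bsub>alg m (a 1)\<^esub>"
      by (metis lincomb_coords lincomb_0 alg_def ring.select_convs(1))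
  qed (simp_all add: alg_def add)
qed

lemma order_alg: "order (alg m (u :: 'v)) = 128"
proof -
  have "CARD('v) = CARD(bit^7)"
    using bij_lincomb bij_betw_same_card by metis
  also have "\<dots> = 128" by (simp add: card_UNIV_bit)
  finally show ?thesis by (simp add: order_def alg_def)
qed

section \<open>The subfield spanned by three basis vectors\<close>

definition subfield_elem :: "bit \<times> bit \<times> bit \<Rightarrow> 'v" where
  "subfield_elem = (\<lambda>(c0, c1, c2). sc c0 (a 1) + sc c1 (a 2) + sc c2 (a 3))"

lemma range_subfield_elem: "range subfield_elem = span {a 1, a 2, a 3}"
proof -
  have "v \<in> span {a 1, a 2, a 3} \<longleftrightarrow> (\<exists>c0 c1 c2. v = sc c0 (a 1) + sc c1 (a 2) + sc c2 (a 3))" for v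
    by (simp add: span_breakdown_eq diff_diff_eq ex_bit eq_diff_eq)
  then show ?thesis
    by (auto simp: subfield_elem_def image_iff)
qed

text \<open>Padding with zeros lets \<open>subfield_elem\<close> inherit injectivity from
  \<open>lincomb\<close>.\<close>

lemma subfield_elem_eq_lincomb:
  "subfield_elem (c0, c1, c2) = lincomb (vector [c0, c1, c2, 0, 0, 0, 0])"
  by (simp add: subfield_elem_def lincomb_def sum_7 vector_7 add.assoc)

lemma inj_subfield_elem: "inj subfield_elem"
proof (rule injI)
  fix c d assume eq: "subfield_elem c = subfield_elem d"
  obtain c0 c1 c2 d0 d1 d2 where cd: "c = (c0, c1, c2)" "d = (d0, d1, d2)"
    by (cases c; cases d)
  have "(vector [c0, c1, c2, 0, 0, 0, 0] :: bit^7) = vector [d0, d1, d2, 0, 0, 0, 0]"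
    using eq unfolding cd subfield_elem_eq_lincomb by (metis coords_lincomb)
  then show "c = d"
    by (simp add: cd vec_eq_iff forall_7 vector_7)
qed

lemma card_span: "card (span {a 1, a 2, a 3}) = 8"
proof -
  have "card (range subfield_elem) = CARD(bit \<times> bit \<times> bit)"
    using inj_subfield_elem by (rule card_image)
  also have "\<dots> = 8"
    using galois_field_gf8 by (simp add: galois_field_def order_def gf8_def)
  finally show ?thesis by (simp add: range_subfield_elem)
qed

text \<open>The first three columns of the first three matrices vanish below row 3, so the span is
  closed. With X for \<open>a 2\<close>, the table reads X X^2 = X + 1 and X^2 X^2 = X +
  X^2.\<close>

lemma structure_products:
  assumes "has_structure_matrices sc a Amat m"
  shows "m (a 1) (a 1) = a 1" "m (a 1) (a 2) = a 2" "m (a 1) (a 3) = a 3"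
    "m (a 2) (a 1) = a 2" "m (a 2) (a 2) = a 3" "m (a 2) (a 3) = a 1 + a 2"
    "m (a 3) (a 1) = a 3" "m (a 3) (a 2) = a 1 + a 2" "m (a 3) (a 3) = a 2 + a 3"
  using assms
  by (simp_all add: has_structure_matrices_def sum_7 Amat_def mat_1_7 A2_def A3_def vector_7)

text \<open>Through this map the span receives associativity, commutativity and inverses from
  \<open>gf8\<close>, although \<open>m\<close> itself is only bilinear.\<close>

lemma subfield_elem_ring_iso:
  assumes m: "bilinear_product sc m" "has_structure_matrices sc a Amat m"
  shows "subfield_elem \<in> ring_iso gf8 ((alg m (a 1))\<lparr>carrier := span {a 1, a 2, a 3}\<rparr>)"
proof (rule ring_iso_memI)
  fix c d :: "bit \<times> bit \<times> bit"
  obtain c0 c1 c2 d0 d1 d2 where cd: "c = (c0, c1, c2)" "d = (d0, d1, d2)"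
    by (cases c; cases d)
  have bilin: "m (u + v) w = m u w + m v w" "m w (u + v) = m w u + m w v"
    "m (sc x u) w = sc x (m u w)" "m w (sc x u) = sc x (m w u)" for u v w x
    using m(1) by (simp_all add: bilinear_product_def Vector_Spaces.linear_iff)
  have "m (subfield_elem c) (subfield_elem d) = subfield_elem (cubic_mult c d)"
    by (simp only: cd subfield_elem_def cubic_mult_def prod.case bilin structure_products[OF m(2)]
        scale_left_distrib scale_right_distrib scale_scale mult.commute add.assoc add.commute add.left_commute)
  then show "subfield_elem (c \<otimes>\<^bsub>gf8\<^esub> d) = subfield_elem c
      \<otimes>\<^bsub>(alg m (a 1))\<lparr>carrier := span {a 1, a 2, a 3}\<rparr>\<^esub> subfield_elem d"
    by (simp add: gf8_def alg_def)
  have "subfield_elem (c + d) = subfield_elem c + subfield_elem d"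
    by (simp only: cd subfield_elem_def prod.case add_Pair scale_left_distrib
        add.assoc add.commute add.left_commute)
  then show "subfield_elem (c \<oplus>\<^bsub>gf8\<^esub> d) = subfield_elem c
      \<oplus>\<^bsub>(alg m (a 1))\<lparr>carrier := span {a 1, a 2, a 3}\<rparr>\<^esub> subfield_elem d"
    by (simp add: gf8_def alg_def)
  show "bij_betw subfield_elem (carrier gf8)
      (carrier ((alg m (a 1))\<lparr>carrier := span {a 1, a 2, a 3}\<rparr>))"
    using inj_subfield_elem by (simp add: bij_betw_def range_subfield_elem gf8_def)
  show "subfield_elem c \<in> carrier ((alg m (a 1))\<lparr>carrier := span {a 1, a 2, a 3}\<rparr>)"
    by (simp flip: range_subfield_elem)
qed (simp add: gf8_def alg_def subfield_elem_def)

lemma galois_field_span: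
  assumes "bilinear_product sc m" "has_structure_matrices sc a Amat m"
  shows "galois_field 8 ((alg m (a 1))\<lparr>carrier := span {a 1, a 2, a 3}\<rparr>)"
proof -
  let ?T = "(alg m (a 1))\<lparr>carrier := span {a 1, a 2, a 3}\<rparr>"
  \<comment> \<open>The transfer puts the image of zero into the record; that image is 0, so the
    update changes nothing.\<close>
  have "field (?T\<lparr>zero := subfield_elem \<zero>\<^bsub>gf8\<^esub>\<rparr>)"
    using field.ring_iso_imp_img_field[OF field_gf8 subfield_elem_ring_iso[OF assms]] .
  moreover have "subfield_elem \<zero>\<^bsub>gf8\<^esub> = 0"
    by (simp add: subfield_elem_def gf8_def zero_prod_def)
  ultimately have "field ?T"
    by (simp add: alg_def)
  then show ?thesis
    using card_span card_ge_0_finite[of "span {a 1, a 2, a 3}"] by (simp add: galois_field_def order_def)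
qed

lemma fractional_semifield_alg:
  assumes m: "bilinear_product sc m" "has_structure_matrices sc a Amat m"
  defines "S \<equiv> alg m (a 1)" and "T \<equiv> span {a 1, a 2, a 3}"
  shows "finite_semifield S" and "subsemifield T S" and "semifield_dim S T = 7 / 3"
    and "fractional_semifield S T"
proof -
  show S: "finite_semifield S"
    unfolding S_def using standard_basis_Amat m by (rule finite_semifield_alg)
  have "finite_semifield (S\<lparr>carrier := T\<rparr>)"
    using galois_field_span[OF m]
    by (intro field_imp_finite_semifield) (simp_all add: galois_field_def S_def T_def)
  with S show sub: "subsemifield T S"
    by (simp add: subsemifield_def S_def alg_def)
  have "prime (2::nat)" by simp
  then have "semifield_dim S T = of_nat 7 / of_nat 3"
    by (rule semifield_dim_eqI) (simp_all add: S_def T_def order_alg card_span)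
  then show dim: "semifield_dim S T = 7 / 3" by simp
  have "(7 / 3 :: rat) \<notin> \<int>"
  proof
    assume "(7 / 3 :: rat) \<in> \<int>"
    then obtain z where "7 / 3 = rat_of_int z" by (auto elim: Ints_cases)
    then have "rat_of_int 7 = rat_of_int (3 * z)" by simp
    then have "7 = 3 * z" by (simp only: of_int_eq_iff)
    then show False by presburger
  qed
  with sub show "fractional_semifield S T"
    unfolding fractional_semifield_def dim by blast
qed

text \<open>Powers multiply on the right starting from the unity, so the cube means the product of
  \<open>a 3\<close> and \<open>a 2\<close> in this order.\<close>

lemma generator_powers:
  assumes "has_structure_matrices sc a Amat m"
  shows "a 3 = a 2 [^]\<^bsub>alg m (a 1)\<^esub> (2::nat)"
    and "a 2 [^]\<^bsub>alg m (a 1)\<^esub> (3::nat) = a 2 \<oplus>\<^bsub>alg m (a 1)\<^esub> a 1"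
  by (simp_all add: nat_pow_def numeral_eq_Suc alg_def structure_products[OF assms] add.commute)

end

section \<open>Arbitrary bases and the concrete space\<close>

lemma bit_basis_7I:
  assumes "is_basis_family sc a"
  shows "bit_basis_7 sc a"
proof -
  interpret finite_dimensional_vector_space sc "range a"
    using assms by (simp add: is_basis_family_def)
  show ?thesis
    by unfold_locales
      (use assms independent_Basis span_Basis in \<open>simp_all add: is_basis_family_def\<close>)
qed

text \<open>The unit vectors provide the basis of \<open>bit^7\<close> on which the semifield of the
  existence claim is built.\<close>

lemma is_basis_family_axis: "is_basis_family (*s) (\<lambda>i. axis i 1)"
proof -
  have "cart_basis = range (\<lambda>i::7. axis i (1::bit))"
    by (auto simp: cart_basis_def)
  then show ?thesis
    using vec.finite_dimensional_vector_space_axioms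
    by (auto simp: is_basis_family_def inj_def axis_eq_axis)
qed

theorem mainTheorem1:
  shows
    "(\<exists>(S :: (bit^7) ring) T.
        finite_semifield S \<and> order S = 128 \<and> subsemifield T S \<and>
        galois_field 8 (S\<lparr>carrier := T\<rparr>) \<and>
        semifield_dim S T = 7 / 3 \<and> fractional_semifield S T) \<and>
     standard_basis Amat \<and>
     (\<forall>(sc :: bit \<Rightarrow> 'v \<Rightarrow> 'v::ab_group_add) (a :: 7 \<Rightarrow> 'v). is_basis_family sc a \<longrightarrow>
        (\<exists>!m. bilinear_product sc m \<and> has_structure_matrices sc a Amat m) \<and>
        (\<forall>m S T. bilinear_product sc m \<and> has_structure_matrices sc a Amat m \<and>
           S = alg m (a 1) \<and> T = module.span sc {a 1, a 2, a 3} \<longrightarrow>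
           finite_semifield S \<and> order S = 128 \<and>
           subsemifield T S \<and>
           galois_field 8 (S\<lparr>carrier := T\<rparr>) \<and>
           (\<forall>F :: 'f ring. galois_field 8 F \<longrightarrow> S\<lparr>carrier := T\<rparr> \<simeq> F) \<and>
           a 3 = a 2 [^]\<^bsub>S\<^esub> (2::nat) \<and>
           a 2 [^]\<^bsub>S\<^esub> (3::nat) = a 2 \<oplus>\<^bsub>S\<^esub> a 1 \<and>
           semifield_dim S T = 7 / 3 \<and> fractional_semifield S T))"
proof (intro conjI allI impI)
  interpret bit_basis_7 "(*s)" "\<lambda>i. axis i 1"
    using is_basis_family_axis by (rule bit_basis_7I)
  obtain m where m: "bilinear_product (*s) m" "has_structure_matrices (*s) (\<lambda>i. axis i 1) Amat m"
    using ex1_bilinear_product by blast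
  show "\<exists>(S :: (bit^7) ring) T.
        finite_semifield S \<and> order S = 128 \<and> subsemifield T S \<and>
        galois_field 8 (S\<lparr>carrier := T\<rparr>) \<and>
        semifield_dim S T = 7 / 3 \<and> fractional_semifield S T"
    using fractional_semifield_alg[OF m] order_alg galois_field_span[OF m] by blast
next
  show "standard_basis Amat" by (rule standard_basis_Amat)
next
  fix sc :: "bit \<Rightarrow> 'v \<Rightarrow> 'v" and a :: "7 \<Rightarrow> 'v"
  assume "is_basis_family sc a"
  then interpret bit_basis_7 sc a
    by (rule bit_basis_7I)
  show "\<exists>!m. bilinear_product sc m \<and> has_structure_matrices sc a Amat m"
    by (rule ex1_bilinear_product)
  fix m and S :: "'v ring" and T
  assume "bilinear_product sc m \<and> has_structure_matrices sc a Amat m \<and>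
    S = alg m (a 1) \<and> T = module.span sc {a 1, a 2, a 3}"
  then have m: "bilinear_product sc m" "has_structure_matrices sc a Amat m"
    and ST: "S = alg m (a 1)" "T = span {a 1, a 2, a 3}" by auto
  note [simp] = ST
  show "finite_semifield S" "subsemifield T S" "semifield_dim S T = 7 / 3" "fractional_semifield S T"
    using fractional_semifield_alg[OF m] by simp_all
  show "order S = 128" by (simp add: order_alg)
  show galois: "galois_field 8 (S\<lparr>carrier := T\<rparr>)"
    using galois_field_span[OF m] by simp
  show "S\<lparr>carrier := T\<rparr> \<simeq> F" if "galois_field 8 F" for F :: "'f ring"
    using galois that by (rule galois_field_8_unique)
  show "a 3 = a 2 [^]\<^bsub>S\<^esub> (2::nat)" "a 2 [^]\<^bsub>S\<^esub> (3::nat) = a 2 \<oplus>\<^bsub>S\<^esub> a 1"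
    using generator_powers[OF m(2)] by simp_all
qed

end
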